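(* Let $1 \leq t \leq r_1 \leq \dots \leq r_k$ (with $k\geq 2$), and for each $i \in [k]$ let $\mathcal{F}_i$ be a $(\leq r_i)$-family and $m_i$ an integer with $m_i \geq c(r_{k-1},r_k,t)+t$. Then $(\mathcal{S}^*_{\mathcal{F}_1,m_1}, \dots, \mathcal{S}^*_{\mathcal{F}_k,m_k})$ has the strict cross-$t$-star property.
   Context: All sets and families are finite. For an $r$-element set $X=\{x_1,\dots,x_r\}$ and integer $m\geq1$, $\mathcal{S}^*_{X,m}=\{\{(x_1,y_1),\dots,(x_r,y_r)\}: y_1,\dots,y_r \text{ distinct elements of } [m]\}$, with $\mathcal{S}^*_{\emptyset,m}=\emptyset$; for a family $\mathcal{F}$, $\mathcal{S}^*_{\mathcal{F},m}=\bigcup_{F\in\mathcal{F}}\mathcal{S}^*_{F,m}$. A $(\leq r)$-family is one whose sets each have at most $r$ elements. $c(r,s,t)=\max\{r\binom{s}{t},s\binom{r}{t}\}+1$ if $t\leq\min\{r,s\}$, and $1$ otherwise. $\mathcal{G}(T)=\{G\in\mathcal{G}:T\subseteq G\}$ and $l(\mathcal{G},t)=\max_{|T|=t}|\mathcal{G}(T)|$. Families $\mathcal{A}_1,\dots,\mathcal{A}_k$ are cross-$t$-intersecting if for all distinct $i,j$ each set of $\mathcal{A}_i$ shares at least $t$ elements with each set of $\mathcal{A}_j$; the tuple is below $(\mathcal{G}_1,\dots,\mathcal{G}_k)$ if $\mathcal{A}_i\subseteq\mathcal{G}_i$. Strict cross-$t$-star property of $(\mathcal{G}_1,\dots,\mathcal{G}_k)$: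 for every cross-$t$-intersecting tuple below it, $\prod|\mathcal{A}_i|\leq\prod l(\mathcal{G}_i,t)$, with strict inequality unless there is a $t$-set $T$ with $\mathcal{A}_i=\mathcal{G}_i(T)$ for all $i$.
   Formalization: The product bound holds as stated; the strictness part is proved only when every F_i has a member with at least t elements, since otherwise (e.g. F_1 empty, F_2={{0}}, t=1) both products can be 0 with no common t-set T. *)

theory Defs
  imports Main "HOL-Library.FuncSet"
begin

definition S_star :: "'a set \<Rightarrow> nat \<Rightarrow> ('a \<times> nat) set set" where
  "S_star X m =
     (if X = {} then {}
      else {(\<lambda>x. (x, y x)) ` X | y. y \<in> X \<rightarrow> {1..m} \<and> inj_on y X})"

definition S_star_family :: "'a set set \<Rightarrow> nat \<Rightarrow> ('a \<times> nat) set set" where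
  "S_star_family \<F> m = (\<Union>F\<in>\<F>. S_star F m)"

definition le_family :: "nat \<Rightarrow> 'a set set \<Rightarrow> bool" where
  "le_family r \<F> \<longleftrightarrow> finite \<F> \<and> (\<forall>F\<in>\<F>. finite F \<and> card F \<le> r)"

definition c_bound :: "nat \<Rightarrow> nat \<Rightarrow> nat \<Rightarrow> nat" where
  "c_bound r s t = (if t \<le> min r s then max (r * (s choose t)) (s * (r choose t)) + 1 else 1)"

definition containing :: "'b set set \<Rightarrow> 'b set \<Rightarrow> 'b set set" where
  "containing \<G> T = {G \<in> \<G>. T \<subseteq> G}"

(* T ranges over all t-element sets of the ground type, so over an infinite type
   (such as 'a \<times> nat below) and for finite \<G> this is the maximum of a nonempty
   finite set. *)
definition max_star :: "'b set set \<Rightarrow> nat \<Rightarrow> nat" where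
  "max_star \<G> t = Max {card (containing \<G> T) | T. finite T \<and> card T = t}"

text \<open>Tuples of \<open>k\<close> families are functions on \<open>nat\<close>, of which only the values on
  \<open>{1..k}\<close> matter.\<close>

definition cross_t_intersecting :: "nat \<Rightarrow> nat \<Rightarrow> (nat \<Rightarrow> 'b set set) \<Rightarrow> bool" where
  "cross_t_intersecting t k \<A> \<longleftrightarrow>
     (\<forall>i\<in>{1..k}. \<forall>j\<in>{1..k}. i \<noteq> j \<longrightarrow>
        (\<forall>A\<in>\<A> i. \<forall>B\<in>\<A> j. t \<le> card (A \<inter> B)))"

definition below :: "nat \<Rightarrow> (nat \<Rightarrow> 'b set set) \<Rightarrow> (nat \<Rightarrow> 'b set set) \<Rightarrow> bool" where
  "below k \<A> \<G> \<longleftrightarrow> (\<forall>i\<in>{1..k}. \<A> i \<subseteq> \<G> i)"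

definition cross_t_star_property :: "nat \<Rightarrow> nat \<Rightarrow> (nat \<Rightarrow> 'b set set) \<Rightarrow> bool" where
  "cross_t_star_property t k \<G> \<longleftrightarrow>
     (\<forall>\<A>. below k \<A> \<G> \<and> cross_t_intersecting t k \<A> \<longrightarrow>
        (\<Prod>i\<in>{1..k}. card (\<A> i)) \<le> (\<Prod>i\<in>{1..k}. max_star (\<G> i) t))"

definition strict_cross_t_star_property :: "nat \<Rightarrow> nat \<Rightarrow> (nat \<Rightarrow> 'b set set) \<Rightarrow> bool" where
  "strict_cross_t_star_property t k \<G> \<longleftrightarrow>
     (\<forall>\<A>. below k \<A> \<G> \<and> cross_t_intersecting t k \<A> \<longrightarrow>
        (\<Prod>i\<in>{1..k}. card (\<A> i)) \<le> (\<Prod>i\<in>{1..k}. max_star (\<G> i) t) \<and>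
        ((\<Prod>i\<in>{1..k}. card (\<A> i)) < (\<Prod>i\<in>{1..k}. max_star (\<G> i) t) \<or>
         (\<exists>T. finite T \<and> card T = t \<and> (\<forall>i\<in>{1..k}. \<A> i = containing (\<G> i) T))))"

text \<open>The strict property fails, for trivial reasons, if some \<open>max_star (\<G> i) t\<close> is \<open>0\<close> while
  some \<open>\<G> j\<close> is a nonempty family \<open>S_star_family (\<F> j) m\<close> with \<open>m\<close> large: take
  \<open>\<A> j = \<G> j\<close> and all other \<open>\<A> i\<close> empty, so that both products are \<open>0\<close> but the
  members of \<open>\<A> j\<close> have no common element.  Hence strictness has to be claimed for
  families \<open>\<F> i\<close> that each have a member with at least \<open>t\<close> elements (equivalently, for
  the values of \<open>m\<close> considered, \<open>max_star (\<G> i) t > 0\<close>), whereas the bound on the product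
  needs no such condition.\<close>

end

theory Submission
  imports Defs "HOL-Combinatorics.Transposition"
begin

text \<open>Swapping two values of the injections shows that, in the families considered, a
  \<open>(t+1)\<close>-star is smaller than the largest \<open>t\<close>-star by a factor of at least \<open>m - t\<close>.
  For two cross-\<open>t\<close>-intersecting families \<open>\<A>\<close> and \<open>\<B>\<close> this suffices: either some
  \<open>t\<close>-set lies in all members of both, or one of the families is covered by few
  \<open>(t+1)\<close>-stars while the other is covered by few \<open>t\<close>-stars.  For \<open>k\<close> families one multiplies
  the inequalities for all pairs; the \<open>t\<close>-sets obtained for the pairs agree, because a largest
  \<open>t\<close>-star determines its centre.\<close>

section \<open>Stars\<close>

lemma finite_containing: "finite \<G> \<Longrightarrow> finite (containing \<G> T)"
  by (simp add: containing_def)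

lemma card_containing_mono:
  "finite \<G> \<Longrightarrow> \<A> \<subseteq> \<G> \<Longrightarrow> card (containing \<A> T) \<le> card (containing \<G> T)"
  by (intro card_mono finite_containing) (auto simp: containing_def)

lemma card_containing_le_max_star:
  assumes "finite \<G>" "finite T" "card T = t"
  shows "card (containing \<G> T) \<le> max_star \<G> t"
  unfolding max_star_def
proof (rule Max_ge)
  \<comment> \<open>The centres \<open>T\<close> may range over infinitely many sets, but the
    cardinalities of their stars are bounded by \<open>card \<G>\<close>, so \<open>Max\<close> is
    taken over a finite set.\<close>
  have "{card (containing \<G> T) |T. finite T \<and> card T = t} \<subseteq> {..card \<G>}"
    using assms(1) by (auto simp: containing_def intro!: card_mono)
  then show "finite {card (containing \<G> T) |T. finite T \<and> card T = t}"
    by (rule finite_subset) simp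
qed (use assms in auto)

lemma max_star_pos:
  assumes "finite \<G>" "G \<in> \<G>" "finite G" "t \<le> card G"
  shows "0 < max_star \<G> t"
proof -
  obtain T where T: "T \<subseteq> G" "card T = t" "finite T"
    using obtain_subset_with_card_n[OF assms(4)] by metis
  have "G \<in> containing \<G> T"
    using T assms by (simp add: containing_def)
  then have "0 < card (containing \<G> T)"
    using finite_containing[OF assms(1)] card_gt_0_iff by blast
  also have "\<dots> \<le> max_star \<G> t"
    by (rule card_containing_le_max_star) (use T assms in auto)
  finally show ?thesis .
qed

text \<open>Every member of \<open>\<B>\<close> contains a \<open>t\<close>-subset of
  \<open>A\<close>, so the \<open>t\<close>-stars centred at such subsets cover \<open>\<B>\<close>.
  The factor \<open>c\<close> stands for a bound of the form \<open>n / c\<close> on each star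
  without leaving the natural numbers.\<close>

lemma card_le_choose_stars:
  fixes c n :: nat
  assumes "finite \<B>" "finite A" "card A \<le> r"
    and meet: "\<And>B. B \<in> \<B> \<Longrightarrow> t \<le> card (A \<inter> B)"
    and bound: "\<And>T. finite T \<Longrightarrow> card T = t \<Longrightarrow> c * card (containing \<B> T) \<le> n"
  shows "c * card \<B> \<le> (r choose t) * n"
proof -
  let ?S = "{T. T \<subseteq> A \<and> card T = t}"
  have "finite ?S"
    using assms by simp
  have "\<B> \<subseteq> (\<Union>T\<in>?S. containing \<B> T)"
  proof
    fix B assume B: "B \<in> \<B>"
    obtain T where "T \<subseteq> A \<inter> B" "card T = t"
      using obtain_subset_with_card_n[OF meet[OF B]] by metis
    then show "B \<in> (\<Union>T\<in>?S. containing \<B> T)"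
      using B by (auto simp: containing_def)
  qed
  then have "card \<B> \<le> card (\<Union>T\<in>?S. containing \<B> T)"
    using \<open>finite ?S\<close> assms(1) by (intro card_mono finite_UN_I finite_containing)
  also have "\<dots> \<le> (\<Sum>T\<in>?S. card (containing \<B> T))"
    by (rule card_UN_le) fact
  finally have "c * card \<B> \<le> (\<Sum>T\<in>?S. c * card (containing \<B> T))"
    by (simp add: sum_distrib_left[symmetric])
  also have "\<dots> \<le> card ?S * n"
    using sum_bounded_above[of ?S "\<lambda>T. c * card (containing \<B> T)" n]
      bound finite_subset[OF _ assms(2)] by auto
  also have "card ?S = (card A choose t)"
    by (rule n_subsets) fact
  also have "(card A choose t) * n \<le> (r choose t) * n"
    using assms by (intro mult_right_mono binomial_right_mono) auto
  finally show ?thesis .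
qed

text \<open>If \<open>B\<close> contains \<open>T\<close> but \<open>T\<close> is not inside
  \<open>A\<close>, then \<open>A \<inter> T\<close> has fewer than \<open>t\<close> elements, so
  \<open>B\<close> must meet \<open>A\<close> outside \<open>T\<close>. Hence the
  \<open>(t+1)\<close>-stars at \<open>insert z T\<close> with \<open>z\<close> in
  \<open>A - T\<close> cover the star at \<open>T\<close>.\<close>

lemma card_containing_le_stars:
  fixes c n :: nat
  assumes "finite \<B>" "finite A" "card A \<le> r" "finite T" "card T = t" "\<not> T \<subseteq> A"
    and meet: "\<And>B. B \<in> \<B> \<Longrightarrow> t \<le> card (A \<inter> B)"
    and bound: "\<And>U. finite U \<Longrightarrow> card U = Suc t \<Longrightarrow> c * card (containing \<B> U) \<le> n"
  shows "c * card (containing \<B> T) \<le> r * n"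
proof -
  have "containing \<B> T \<subseteq> (\<Union>z\<in>A - T. containing \<B> (insert z T))"
  proof
    fix B assume B: "B \<in> containing \<B> T"
    have "\<not> A \<inter> B \<subseteq> T"
    proof
      assume "A \<inter> B \<subseteq> T"
      then have "A \<inter> B \<subset> T"
        using \<open>\<not> T \<subseteq> A\<close> by auto
      then have "card (A \<inter> B) < t"
        using assms psubset_card_mono by metis
      then show False
        using meet B by (fastforce simp: containing_def)
    qed
    then show "B \<in> (\<Union>z\<in>A - T. containing \<B> (insert z T))"
      using B by (auto simp: containing_def)
  qed
  then have "card (containing \<B> T) \<le> card (\<Union>z\<in>A - T. containing \<B> (insert z T))"
    using assms by (intro card_mono finite_UN_I finite_containing) auto
  also have "\<dots> \<le> (\<Sum>z\<in>A - T. card (containing \<B> (insert z T)))"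
    using assms by (intro card_UN_le) simp
  finally have "c * card (containing \<B> T) \<le> (\<Sum>z\<in>A - T. c * card (containing \<B> (insert z T)))"
    by (simp add: sum_distrib_left[symmetric])
  also have "\<dots> \<le> card (A - T) * n"
    using sum_bounded_above[of "A - T" "\<lambda>z. c * card (containing \<B> (insert z T))" n]
      bound assms by auto
  also have "card (A - T) \<le> r"
    using assms card_mono[of A "A - T"] by auto
  finally show ?thesis
    by simp
qed

text \<open>A second centre of the same star would supply a point \<open>z\<close> outside
  \<open>T\<close> lying in every member, turning the \<open>t\<close>-star at \<open>T\<close> into
  a \<open>(t+1)\<close>-star, which is too small. This makes the centres found for different pairs
  of families agree.\<close>

lemma containing_inject:
  assumes "finite \<G>" "finite T" "finite T'" "card T = t" "card T' = t"
    and eq: "containing \<G> T = containing \<G> T'"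
    and pos: "0 < card (containing \<G> T)"
    and bound: "\<And>U. finite U \<Longrightarrow> card U = Suc t \<Longrightarrow>
      card (containing \<G> U) < card (containing \<G> T)"
  shows "T = T'"
proof (rule ccontr)
  assume "T \<noteq> T'"
  then have "\<not> T' \<subseteq> T"
    using assms card_subset_eq by metis
  then obtain z where z: "z \<in> T'" "z \<notin> T"
    by auto
  have "containing \<G> T \<subseteq> containing \<G> (insert z T)"
    using eq z by (auto simp: containing_def)
  then have "card (containing \<G> T) \<le> card (containing \<G> (insert z T))"
    using assms by (intro card_mono finite_containing)
  moreover have "card (containing \<G> (insert z T)) < card (containing \<G> T)"
    by (rule bound) (use assms z in auto)
  ultimately show False
    by simp
qed

section \<open>Two families\<close>

text \<open>Cross-multiplied form of \<open>a / x \<le> p / c\<close> and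
  \<open>b / y \<le> q / c\<close> with \<open>(p / c) * (q / c) < 1\<close>.\<close>

lemma mult_less_of_scaled_bounds:
  fixes c a b p q x y :: nat
  assumes "c * a \<le> p * x" "c * b \<le> q * y" "p * q < c * c" "0 < x" "0 < y"
  shows "a * b < x * y"
proof -
  have "(c * c) * (a * b) = (c * a) * (c * b)"
    by (simp add: algebra_simps)
  also have "\<dots> \<le> (p * x) * (q * y)"
    using assms(1,2) by (rule mult_le_mono)
  also have "\<dots> = (p * q) * (x * y)"
    by (simp add: algebra_simps)
  also have "\<dots> < (c * c) * (x * y)"
    using assms by (intro mult_strict_right_mono) auto
  finally show ?thesis
    by simp
qed

text \<open>The unbalanced case. The set \<open>B0\<close>, which misses part of \<open>T\<close>,
  forces \<open>\<A>\<close> (its own star at \<open>T\<close>) into at most \<open>s\<close> stars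
  of size at most \<open>x / c\<close>, while \<open>A0\<close> covers \<open>\<B>\<close> by at
  most \<open>r choose t\<close> stars of size at most \<open>y\<close>. The product of the two
  factors is below 1 by the hypothesis on \<open>c\<close>.\<close>

lemma cross_star_less:
  fixes c x y :: nat
  assumes fin: "finite \<A>" "finite \<B>" "\<And>B. B \<in> \<B> \<Longrightarrow> finite B \<and> card B \<le> s"
    and A0: "A0 \<in> \<A>" "finite A0" "card A0 \<le> r"
    and meet: "\<And>A B. A \<in> \<A> \<Longrightarrow> B \<in> \<B> \<Longrightarrow> t \<le> card (A \<inter> B)"
    and T: "finite T" "card T = t" "\<And>A. A \<in> \<A> \<Longrightarrow> T \<subseteq> A"
    and B0: "B0 \<in> \<B>" "\<not> T \<subseteq> B0"
    and U: "\<And>U. finite U \<Longrightarrow> card U = Suc t \<Longrightarrow> c * card (containing \<A> U) \<le> x"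
    and V: "\<And>V. finite V \<Longrightarrow> card V = t \<Longrightarrow> card (containing \<B> V) \<le> y"
    and c: "s * (r choose t) < c"
    and pos: "0 < x" "0 < y"
  shows "card \<A> * card \<B> < x * y"
proof -
  have "containing \<A> T = \<A>"
    using T by (auto simp: containing_def)
  then have "c * card \<A> \<le> s * x"
    using card_containing_le_stars[of \<A> B0 s T t c x] fin B0 T U meet
    by (simp add: Int_commute)
  \<comment> \<open>Only \<open>t\<close>-stars of \<open>\<B>\<close> are controlled here, so
    nothing is gained from \<open>c\<close>; the bound is scaled by \<open>c\<close> merely to fit
    the shape of \<open>mult_less_of_scaled_bounds\<close>.\<close>
  moreover have "c * card \<B> \<le> (c * (r choose t)) * y"
    using card_le_choose_stars[of \<B> A0 r t 1 y] fin A0 V meet by simp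
  moreover have "s * (c * (r choose t)) < c * c"
    using c by (simp add: algebra_simps)
  ultimately show ?thesis
    using pos by (rule mult_less_of_scaled_bounds)
qed

text \<open>The two bounds on \<open>c\<close> settle the two unbalanced cases, and their product
  settles the case without a \<open>t\<close>-set common to either family. Nonemptiness excludes the
  degenerate equality of two zero products.\<close>

lemma cross_t_star_pair:
  fixes c :: nat
  assumes G: "finite \<G>" "\<And>G. G \<in> \<G> \<Longrightarrow> finite G \<and> card G \<le> r"
    and H: "finite \<H>" "\<And>H. H \<in> \<H> \<Longrightarrow> finite H \<and> card H \<le> s"
    and sub: "\<A> \<subseteq> \<G>" "\<B> \<subseteq> \<H>"
    and ne: "\<A> \<noteq> {}" "\<B> \<noteq> {}"
    and meet: "\<And>A B. A \<in> \<A> \<Longrightarrow> B \<in> \<B> \<Longrightarrow> t \<le> card (A \<inter> B)"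
    and GU: "\<And>U. finite U \<Longrightarrow> card U = Suc t \<Longrightarrow> c * card (containing \<G> U) \<le> max_star \<G> t"
    and HU: "\<And>U. finite U \<Longrightarrow> card U = Suc t \<Longrightarrow> c * card (containing \<H> U) \<le> max_star \<H> t"
    and c: "r * (s choose t) < c" "s * (r choose t) < c"
  shows "card \<A> * card \<B> < max_star \<G> t * max_star \<H> t \<or>
    (\<exists>T. finite T \<and> card T = t \<and> \<A> = containing \<G> T \<and> \<B> = containing \<H> T \<and>
      card \<A> = max_star \<G> t \<and> card \<B> = max_star \<H> t)"
proof -
  let ?x = "max_star \<G> t" and ?y = "max_star \<H> t"
  have finA: "finite \<A>" and finB: "finite \<B>"
    using G H sub by (auto intro: finite_subset)
  have A: "finite A \<and> card A \<le> r" if "A \<in> \<A>" for A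
    using G sub that by auto
  have B: "finite B \<and> card B \<le> s" if "B \<in> \<B>" for B
    using H sub that by auto
  obtain A0 B0 where A0: "A0 \<in> \<A>" and B0: "B0 \<in> \<B>"
    using ne by auto
  have "t \<le> card A0" "t \<le> card B0"
    using meet[OF A0 B0] A[OF A0] B[OF B0] card_mono[of A0 "A0 \<inter> B0"] card_mono[of B0 "A0 \<inter> B0"]
    by auto
  then have pos: "0 < ?x" "0 < ?y"
    using max_star_pos[of \<G> A0 t] max_star_pos[of \<H> B0 t] A0 B0 A B G H sub by auto
  have AU: "c * card (containing \<A> U) \<le> ?x" if "finite U" "card U = Suc t" for U
    using GU[OF that] card_containing_mono[OF G(1) sub(1), of U] mult_le_mono2 le_trans by blast
  have BU: "c * card (containing \<B> U) \<le> ?y" if "finite U" "card U = Suc t" for U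
    using HU[OF that] card_containing_mono[OF H(1) sub(2), of U] mult_le_mono2 le_trans by blast
  have AT: "card (containing \<A> T) \<le> ?x" if "finite T" "card T = t" for T
    using card_containing_le_max_star[OF G(1) that] card_containing_mono[OF G(1) sub(1), of T]
    by simp
  have BT: "card (containing \<B> T) \<le> ?y" if "finite T" "card T = t" for T
    using card_containing_le_max_star[OF H(1) that] card_containing_mono[OF H(1) sub(2), of T]
    by simp
  have meet': "t \<le> card (B \<inter> A)" if "A \<in> \<A>" "B \<in> \<B>" for A B
    using meet[OF that] by (simp add: Int_commute)
  consider
      (common) T where "finite T" "card T = t" "T \<subseteq> \<Inter>\<A>" "T \<subseteq> \<Inter>\<B>"
    | (left) T where "finite T" "card T = t" "T \<subseteq> \<Inter>\<A>" "\<not> T \<subseteq> \<Inter>\<B>"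
    | (right) T where "finite T" "card T = t" "T \<subseteq> \<Inter>\<B>" "\<not> T \<subseteq> \<Inter>\<A>"
    | (neither) "\<And>T. finite T \<Longrightarrow> card T = t \<Longrightarrow> \<not> T \<subseteq> \<Inter>\<A> \<and> \<not> T \<subseteq> \<Inter>\<B>"
    by metis
  then show ?thesis
  proof cases
    case common
    let ?C = "containing \<G> T" and ?D = "containing \<H> T"
    have le: "card ?C \<le> ?x" "card ?D \<le> ?y"
      using card_containing_le_max_star common G H by auto
    have AC: "\<A> \<subseteq> ?C" and BD: "\<B> \<subseteq> ?D"
      using common sub by (auto simp: containing_def)
    have cards: "card \<A> \<le> card ?C" "card \<B> \<le> card ?D"
      using AC BD G H finite_containing card_mono by metis+
    show ?thesis
    \<comment> \<open>If both maxima are attained, the families fill their stars at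
      \<open>T\<close>. Otherwise one factor is strictly smaller, and positivity of the other
      maximum makes the product strictly smaller.\<close>
    proof (cases "card \<A> = ?x \<and> card \<B> = ?y")
      case True
      then have "card \<A> = card ?C" "card \<B> = card ?D"
        using cards le by auto
      then have "\<A> = ?C" "\<B> = ?D"
        using AC BD finite_containing[OF G(1)] finite_containing[OF H(1)] card_subset_eq by metis+
      then show ?thesis
        using True common by blast
    next
      case False
      then have "card \<A> < ?x \<and> card \<B> \<le> ?y \<or> card \<A> \<le> ?x \<and> card \<B> < ?y"
        using cards le by linarith
      then have "card \<A> * card \<B> < ?x * ?y"
        using pos order.strict_trans1[OF mult_le_mono2 mult_less_mono1]
          order.strict_trans1[OF mult_le_mono1 mult_less_mono2] by blast
      then show ?thesis ..
    qed
  next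
    case left
    then obtain B1 where "B1 \<in> \<B>" "\<not> T \<subseteq> B1"
      by blast
    moreover have "\<And>A. A \<in> \<A> \<Longrightarrow> T \<subseteq> A"
      using left by blast
    ultimately have "card \<A> * card \<B> < ?x * ?y"
      using cross_star_less[OF finA finB B A0 _ _ meet, of r T B1 c ?x ?y] A[OF A0] AU BT c pos left
      by blast
    then show ?thesis ..
  next
    case right
    then obtain A1 where "A1 \<in> \<A>" "\<not> T \<subseteq> A1"
      by blast
    moreover have "\<And>B. B \<in> \<B> \<Longrightarrow> T \<subseteq> B"
      using right by blast
    ultimately have "card \<B> * card \<A> < ?y * ?x"
      using cross_star_less[OF finB finA A B0 _ _ meet', of s T A1 c ?y ?x] B[OF B0] BU AT c pos right
      by blast
    then show ?thesis
      by (simp add: mult.commute)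
  next
    case neither
    \<comment> \<open>Each \<open>t\<close>-set is missed by some member of the opposite family, so
      both covering arguments apply in turn: \<open>t\<close>-stars cover the family, and
      \<open>(t+1)\<close>-stars cover each \<open>t\<close>-star.\<close>
    have "c * card (containing \<A> T) \<le> s * ?x" if T: "finite T" "card T = t" for T
    proof -
      obtain B1 where "B1 \<in> \<B>" "\<not> T \<subseteq> B1"
        using neither[OF T] by blast
      then show ?thesis
        using card_containing_le_stars[of \<A> B1 s T t c ?x] finA B T AU meet' by auto
    qed
    then have a: "c * card \<A> \<le> (s * (s choose t)) * ?x"
      using card_le_choose_stars[of \<A> B0 s t c "s * ?x"] finA B B0 meet'
      by (auto simp: algebra_simps)
    have "c * card (containing \<B> T) \<le> r * ?y" if T: "finite T" "card T = t" for T
    proof -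
      obtain A1 where "A1 \<in> \<A>" "\<not> T \<subseteq> A1"
        using neither[OF T] by blast
      then show ?thesis
        using card_containing_le_stars[of \<B> A1 r T t c ?y] finB A T BU meet by auto
    qed
    then have b: "c * card \<B> \<le> (r * (r choose t)) * ?y"
      using card_le_choose_stars[of \<B> A0 r t c "r * ?y"] finB A A0 meet
      by (auto simp: algebra_simps)
    \<comment> \<open>The hypotheses do not bound \<open>s * (s choose t)\<close> by
      \<open>c\<close>, but regrouping the product gives exactly the two quantities that they do
      bound.\<close>
    have "(s * (s choose t)) * (r * (r choose t)) = (r * (s choose t)) * (s * (r choose t))"
      by (simp add: algebra_simps)
    also have "\<dots> < c * c"
      using c by (intro mult_strict_mono) auto
    finally have "card \<A> * card \<B> < ?x * ?y"
      using mult_less_of_scaled_bounds[OF a b _ pos] by simp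
    then show ?thesis ..
  qed
qed

text \<open>Lets the single constant built from the two largest size bounds serve every pair of
  indices. The conditions on \<open>t\<close> put \<open>c_bound\<close> in its first
  branch.\<close>

lemma c_bound_mono:
  assumes "r \<le> r'" "s \<le> s'" "t \<le> r" "t \<le> s"
  shows "r * (s choose t) < c_bound r' s' t" "s * (r choose t) < c_bound r' s' t"
proof -
  have "r * (s choose t) \<le> r' * (s' choose t)" "s * (r choose t) \<le> s' * (r' choose t)"
    using assms by (auto intro!: mult_le_mono binomial_right_mono)
  then show "r * (s choose t) < c_bound r' s' t" "s * (r choose t) < c_bound r' s' t"
    using assms by (auto simp: c_bound_def)
qed

section \<open>Products over pairs of indices\<close>

text \<open>Among the ordered pairs of distinct indices, each index occurs \<open>card I - 1\<close>
  times in the first place and equally often in the second.\<close>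

lemma prod_pairs:
  fixes f :: "'i \<Rightarrow> nat"
  assumes "finite I"
  shows "(\<Prod>p\<in>Sigma I (\<lambda>i. I - {i}). f (fst p) * f (snd p)) = (\<Prod>i\<in>I. f i) ^ (2 * (card I - 1))"
proof -
  let ?n = "card I - 1"
  have "(\<Prod>p\<in>Sigma I (\<lambda>i. I - {i}). f (fst p) * f (snd p)) = (\<Prod>i\<in>I. \<Prod>j\<in>I - {i}. f i * f j)"
    using assms by (subst prod.Sigma) (auto simp: case_prod_beta)
  also have "\<dots> = (\<Prod>i\<in>I. f i ^ ?n) * (\<Prod>i\<in>I. \<Prod>j\<in>I - {i}. f j)"
    by (simp add: prod.distrib)
  also have "(\<Prod>i\<in>I. \<Prod>j\<in>I - {i}. f j) = (\<Prod>i\<in>I. \<Prod>j\<in>{j\<in>I. i \<noteq> j}. f j)"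
    by (intro prod.cong) auto
  also have "\<dots> = (\<Prod>j\<in>I. \<Prod>i\<in>{i\<in>I. i \<noteq> j}. f j)"
    by (rule prod.swap_restrict) (use assms in auto)
  also have "\<dots> = (\<Prod>j\<in>I. f j ^ ?n)"
  proof (rule prod.cong)
    fix j assume "j \<in> I"
    moreover have "{i\<in>I. i \<noteq> j} = I - {j}"
      by auto
    ultimately show "(\<Prod>i\<in>{i\<in>I. i \<noteq> j}. f j) = f j ^ ?n"
      by simp
  qed simp
  finally show ?thesis
    by (simp add: prod_power_distrib[symmetric] power_add[symmetric] mult_2)
qed

text \<open>Multiplying over all ordered pairs compares equal powers of the two products; the
  exponent is positive because there are at least two indices, so the root may be taken.\<close>

lemma prod_le_of_pairs:
  fixes a b :: "'i \<Rightarrow> nat"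
  assumes "finite I" "2 \<le> card I"
    and le: "\<And>i j. i \<in> I \<Longrightarrow> j \<in> I \<Longrightarrow> i \<noteq> j \<Longrightarrow> a i * a j \<le> b i * b j"
  shows "(\<Prod>i\<in>I. a i) \<le> (\<Prod>i\<in>I. b i)"
proof -
  have "(\<Prod>i\<in>I. a i) ^ (2 * (card I - 1)) \<le> (\<Prod>i\<in>I. b i) ^ (2 * (card I - 1))"
    unfolding prod_pairs[OF assms(1), symmetric] by (rule prod_mono) (auto intro: le)
  then show ?thesis
    using assms(2) by (simp add: power_mono_iff)
qed

text \<open>One strict pair would make the product over all pairs strict, since the remaining
  factors are positive, whereas equal products have equal powers.\<close>

lemma pairs_eq_of_prod_eq:
  fixes a b :: "'i \<Rightarrow> nat"
  assumes "finite I"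
    and le: "\<And>i j. i \<in> I \<Longrightarrow> j \<in> I \<Longrightarrow> i \<noteq> j \<Longrightarrow> a i * a j \<le> b i * b j"
    and pos: "\<And>i. i \<in> I \<Longrightarrow> 0 < a i"
    and eq: "(\<Prod>i\<in>I. a i) = (\<Prod>i\<in>I. b i)"
    and ij: "i \<in> I" "j \<in> I" "i \<noteq> j"
  shows "a i * a j = b i * b j"
proof (rule ccontr)
  assume "a i * a j \<noteq> b i * b j"
  then have less: "a i * a j < b i * b j"
    using le ij by (simp add: order.not_eq_order_implies_strict)
  let ?P = "Sigma I (\<lambda>i. I - {i})"
  have "finite ?P"
    using assms(1) by auto
  have "(\<Prod>p\<in>?P. a (fst p) * a (snd p)) < (\<Prod>p\<in>?P. b (fst p) * b (snd p))"
  proof -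
    have m: "(i, j) \<in> ?P"
      using ij by auto
    have "(\<Prod>p\<in>?P - {(i, j)}. a (fst p) * a (snd p)) \<le> (\<Prod>p\<in>?P - {(i, j)}. b (fst p) * b (snd p))"
      by (rule prod_mono) (auto intro: le)
    moreover have "0 < (\<Prod>p\<in>?P - {(i, j)}. a (fst p) * a (snd p))"
      using pos by (intro prod_pos) fastforce
    ultimately show ?thesis
      unfolding prod.remove[OF \<open>finite ?P\<close> m] using less
      by (auto intro: mult_less_le_imp_less[OF less])
  qed
  then show False
    unfolding prod_pairs[OF assms(1)] using eq by simp
qed

section \<open>The families of injections\<close>

lemma S_starE:
  assumes "G \<in> S_star X m"
  obtains y where "G = (\<lambda>x. (x, y x)) ` X" "y \<in> X \<rightarrow> {1..m}" "inj_on y X" "X \<noteq> {}"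
  using assms by (auto simp: S_star_def split: if_splits)

lemma card_S_star: "G \<in> S_star X m \<Longrightarrow> card G = card X"
  by (auto elim!: S_starE intro!: card_image inj_onI)

lemma S_star_nonempty:
  assumes "finite X" "X \<noteq> {}" "card X \<le> m"
  shows "S_star X m \<noteq> {}"
proof -
  obtain y where "y ` X \<subseteq> {1..m}" "inj_on y X"
    using card_le_inj[of X "{1..m}"] assms by auto
  then have "(\<lambda>x. (x, y x)) ` X \<in> S_star X m"
    using assms by (auto simp: S_star_def)
  then show ?thesis
    by auto
qed

lemma S_star_family_finite_member:
  assumes "le_family r \<F>" "G \<in> S_star_family \<F> m"
  shows "finite G \<and> card G \<le> r"
proof -
  obtain X where "X \<in> \<F>" "G \<in> S_star X m"
    using assms by (auto simp: S_star_family_def)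
  moreover have "finite G"
    using \<open>X \<in> \<F>\<close> \<open>G \<in> S_star X m\<close> assms(1) by (auto simp: le_family_def elim!: S_starE)
  moreover note card_S_star[OF \<open>G \<in> S_star X m\<close>]
  ultimately show ?thesis
    using assms(1) by (auto simp: le_family_def)
qed

lemma finite_S_star_family:
  assumes "le_family r \<F>"
  shows "finite (S_star_family \<F> m)"
proof -
  have "S_star X m \<subseteq> Pow (X \<times> {1..m})" for X :: "'a set"
    by (auto elim!: S_starE)
  then have "finite (S_star X m)" if "X \<in> \<F>" for X
    using assms that by (intro finite_subset[OF \<open>S_star X m \<subseteq> _\<close>]) (auto simp: le_family_def)
  then show ?thesis
    using assms by (auto simp: S_star_family_def le_family_def)
qed

lemma S_star_family_inj:
  assumes "G \<in> S_star_family \<F> m"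
  shows "inj_on fst G" "inj_on snd G" "G \<subseteq> UNIV \<times> {1..m}"
  using assms by (auto simp: S_star_family_def inj_on_def elim!: S_starE)

text \<open>Relabelling the values by \<open>\<pi>\<close> composes the underlying injection with
  \<open>\<pi>\<close>, which leaves its domain in \<open>\<F>\<close>. It is needed for
  transpositions of two values.\<close>

lemma S_star_family_image:
  assumes G: "G \<in> S_star_family \<F> m" and \<pi>: "inj \<pi>" "\<pi> ` {1..m} \<subseteq> {1..m}"
  shows "map_prod id \<pi> ` G \<in> S_star_family \<F> m"
proof -
  obtain X where "X \<in> \<F>" "G \<in> S_star X m"
    using G by (auto simp: S_star_family_def)
  then obtain y where X: "X \<in> \<F>" "X \<noteq> {}"
    and y: "G = (\<lambda>x. (x, y x)) ` X" "y \<in> X \<rightarrow> {1..m}" "inj_on y X"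
    by (elim S_starE)
  have "map_prod id \<pi> ` G = (\<lambda>x. (x, (\<pi> \<circ> y) x)) ` X"
    using y by (simp add: image_image)
  moreover have "\<pi> \<circ> y \<in> X \<rightarrow> {1..m}"
    using y(2) \<pi>(2) unfolding Pi_iff comp_def by blast
  moreover have "inj_on (\<pi> \<circ> y) X"
    using y(3) \<pi>(1) by (auto intro: comp_inj_on inj_on_subset)
  ultimately have "map_prod id \<pi> ` G \<in> S_star X m"
    using X unfolding S_star_def by auto
  then show ?thesis
    using X by (auto simp: S_star_family_def)
qed

text \<open>The stars at \<open>insert (x, v) T\<close>, for the at least \<open>m - t\<close> values \<open>v\<close> not occurring in \<open>T\<close>,
  are pairwise disjoint, and a transposition of values maps the star at \<open>insert (x, y) T\<close>
  injectively into each of them.\<close>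

lemma S_star_family_star_ratio:
  assumes F: "le_family r \<F>" and U: "finite U" "card U = Suc t"
  shows "(m - t) * card (containing (S_star_family \<F> m) U) \<le> max_star (S_star_family \<F> m) t"
proof (cases "containing (S_star_family \<F> m) U = {}")
  case False
  let ?\<G> = "S_star_family \<F> m"
  obtain G where G: "G \<in> ?\<G>" "U \<subseteq> G"
    using False by (auto simp: containing_def)
  note inj = S_star_family_inj[OF G(1)]
  have "U \<noteq> {}"
    using U by auto
  then obtain x y where xy: "(x, y) \<in> U"
    by auto
  define T where "T = U - {(x, y)}"
  have T: "finite T" "card T = t" "U = insert (x, y) T"
    using U xy by (auto simp: T_def)
  \<comment> \<open>The value \<open>y\<close> itself belongs to \<open>V\<close>. The truncated
    difference \<open>m - t\<close> is 0 when \<open>m < t\<close>, where the claim is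
    trivial.\<close>
  define V where "V = {1..m} - snd ` T"
  have "m - t \<le> card {1..m} - card (snd ` T)"
    using card_image_le[OF T(1), of snd] T(2) by simp
  also have "\<dots> \<le> card V"
    unfolding V_def by (rule diff_card_le_card_Diff) (use T in simp)
  finally have V: "m - t \<le> card V" .
  have finG: "finite ?\<G>"
    using F by (rule finite_S_star_family)
  have y: "y \<in> {1..m}" "y \<notin> snd ` T"
  proof -
    show "y \<in> {1..m}"
      using G xy inj(3) by auto
    show "y \<notin> snd ` T"
      using inj_onD[OF inj(2)] G xy by (fastforce simp: T_def)
  qed
  have shift: "card (containing ?\<G> U) \<le> card (containing ?\<G> (insert (x, v) T))" if v: "v \<in> V" for v
  proof (rule card_inj_on_le)
    let ?f = "map_prod id (transpose y v) :: 'a \<times> nat \<Rightarrow> 'a \<times> nat"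
    have "inj ?f"
      by (intro prod.inj_map) auto
    then show "inj_on (image ?f) (containing ?\<G> U)"
      by (meson inj_image_eq_iff inj_onI)
    \<comment> \<open>Neither \<open>y\<close> nor \<open>v\<close> occurs as a value in
      \<open>T\<close>: the former by injectivity of \<open>G\<close> on values, the latter by the
      choice of \<open>V\<close>.\<close>
    have "?f p = p" if "p \<in> T" for p
    proof -
      have "snd p \<in> snd ` T"
        using that by (rule imageI)
      then have "snd p \<noteq> y" "snd p \<noteq> v"
        using y v by (auto simp: V_def)
      then show ?thesis
        by (cases p) simp
    qed
    then have fT: "?f ` T = T"
      by simp
    have "transpose y v ` {1..m} \<subseteq> {1..m}"
      using y v by (auto simp: V_def transpose_def)
    then have "?f ` H \<in> ?\<G>" if "H \<in> ?\<G>" for H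
      using S_star_family_image[OF that, of "transpose y v"] by simp
    moreover have "insert (x, v) T \<subseteq> ?f ` H" if "U \<subseteq> H" for H
    proof -
      have "?f ` U \<subseteq> ?f ` H"
        using that by (rule image_mono)
      moreover have "?f ` U = insert (x, v) T"
        by (simp add: T(3) fT)
      ultimately show ?thesis
        by simp
    qed
    ultimately show "image ?f ` containing ?\<G> U \<subseteq> containing ?\<G> (insert (x, v) T)"
      unfolding containing_def by blast
    show "finite (containing ?\<G> (insert (x, v) T))"
      using finG by (rule finite_containing)
  qed
  have "(m - t) * card (containing ?\<G> U) \<le> card V * card (containing ?\<G> U)"
    using V by simp
  also have "\<dots> \<le> (\<Sum>v\<in>V. card (containing ?\<G> (insert (x, v) T)))"
    using sum_bounded_below[of V "card (containing ?\<G> U)"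
        "\<lambda>v. card (containing ?\<G> (insert (x, v) T))"] shift by simp
  \<comment> \<open>Members are graphs of functions, so none contains both \<open>(x, v)\<close> and
    \<open>(x, w)\<close> for \<open>v \<noteq> w\<close>.\<close>
  also have "\<dots> = card (\<Union>v\<in>V. containing ?\<G> (insert (x, v) T))"
  proof (rule card_UN_disjoint[symmetric])
    show "\<forall>v\<in>V. \<forall>w\<in>V. v \<noteq> w \<longrightarrow>
      containing ?\<G> (insert (x, v) T) \<inter> containing ?\<G> (insert (x, w) T) = {}"
      using S_star_family_inj(1) by (fastforce simp: containing_def inj_on_def)
  qed (auto simp: V_def finG finite_containing)
  also have "\<dots> \<le> card (containing ?\<G> T)"
    by (intro card_mono finite_containing finG) (auto simp: containing_def)
  also have "\<dots> \<le> max_star ?\<G> t"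
    using finG T by (intro card_containing_le_max_star)
  finally show ?thesis .
qed simp

section \<open>Passage from pairs to \<open>k\<close> families of injections\<close>

theorem theorem4p6:
  fixes t k :: nat and r m :: "nat \<Rightarrow> nat" and \<F> :: "nat \<Rightarrow> 'a set set"
  assumes "k \<ge> 2"
    and "1 \<le> t" and "t \<le> r 1"
    and "\<And>i j. 1 \<le> i \<Longrightarrow> i \<le> j \<Longrightarrow> j \<le> k \<Longrightarrow> r i \<le> r j"
    and "\<And>i. i \<in> {1..k} \<Longrightarrow> le_family (r i) (\<F> i)"
    and "\<And>i. i \<in> {1..k} \<Longrightarrow> m i \<ge> c_bound (r (k - 1)) (r k) t + t"
  shows "cross_t_star_property t k (\<lambda>i. S_star_family (\<F> i) (m i)) \<and>
    ((\<forall>i\<in>{1..k}. \<exists>F\<in>\<F> i. t \<le> card F) \<longrightarrow>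
      strict_cross_t_star_property t k (\<lambda>i. S_star_family (\<F> i) (m i)))"
proof -
  define \<G> where "\<G> i = S_star_family (\<F> i) (m i)" for i
  define c where "c = c_bound (r (k - 1)) (r k) t"
  define l where "l i = max_star (\<G> i) t" for i
  have tr: "t \<le> r i" if "i \<in> {1..k}" for i
    using assms(3) assms(4)[of 1 i] that by auto
  have fin: "finite (\<G> i)" if "i \<in> {1..k}" for i
    using finite_S_star_family assms(5)[OF that] by (auto simp: \<G>_def)
  have mem: "finite G \<and> card G \<le> r i" if "i \<in> {1..k}" "G \<in> \<G> i" for i G
    using S_star_family_finite_member assms(5)[OF that(1)] that(2) by (auto simp: \<G>_def)
  have ratio: "c * card (containing (\<G> i) U) \<le> l i"
    if "i \<in> {1..k}" "finite U" "card U = Suc t" for i U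
  proof -
    have "c \<le> m i - t"
      using assms(6)[OF that(1)] by (simp add: c_def)
    then have "c * card (containing (\<G> i) U) \<le> (m i - t) * card (containing (\<G> i) U)"
      by (rule mult_right_mono) simp
    also have "\<dots> \<le> l i"
      using S_star_family_star_ratio[OF assms(5)[OF that(1)] that(2,3)] by (simp add: \<G>_def l_def)
    finally show ?thesis .
  qed
  \<comment> \<open>For \<open>i < j\<close> one has \<open>i \<le> k - 1\<close> and
    \<open>j \<le> k\<close>, which is why \<open>c\<close> involves \<open>r (k - 1)\<close> and
    \<open>r k\<close> only.\<close>
  have cb: "r i * (r j choose t) < c \<and> r j * (r i choose t) < c"
    if "i \<in> {1..k}" "j \<in> {1..k}" "i < j" for i j
    using c_bound_mono[of "r i" "r (k - 1)" "r j" "r k" t] assms(4)[of i "k - 1"]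
      assms(4)[of j k] that tr[of i] tr[of j] by (auto simp: c_def)
  have c: "r i * (r j choose t) < c \<and> r j * (r i choose t) < c"
    if "i \<in> {1..k}" "j \<in> {1..k}" "i \<noteq> j" for i j
    using cb[of i j] cb[of j i] that by (cases "i < j") auto
  have pair: "card (\<A> i) * card (\<A> j) < l i * l j \<or>
      (\<exists>T. finite T \<and> card T = t \<and> \<A> i = containing (\<G> i) T \<and> \<A> j = containing (\<G> j) T \<and>
        card (\<A> i) = l i \<and> card (\<A> j) = l j)"
    if "below k \<A> \<G>" "cross_t_intersecting t k \<A>" "i \<in> {1..k}" "j \<in> {1..k}" "i \<noteq> j"
      "\<A> i \<noteq> {}" "\<A> j \<noteq> {}" for \<A> i j
    unfolding l_def
  proof (rule cross_t_star_pair)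
    show "\<A> i \<subseteq> \<G> i" "\<A> j \<subseteq> \<G> j"
      using that by (simp_all add: below_def)
    show "t \<le> card (A \<inter> B)" if "A \<in> \<A> i" "B \<in> \<A> j" for A B
      using \<open>cross_t_intersecting t k \<A>\<close> \<open>i \<in> _\<close> \<open>j \<in> _\<close> \<open>i \<noteq> j\<close> that
      unfolding cross_t_intersecting_def by blast
  qed (use that(3-) fin mem ratio[unfolded l_def] c[of i j] in blast)+
  have pair_le: "card (\<A> i) * card (\<A> j) \<le> l i * l j"
    if "below k \<A> \<G>" "cross_t_intersecting t k \<A>" "i \<in> {1..k}" "j \<in> {1..k}" "i \<noteq> j" for \<A> i j
    using pair[OF that] by (cases "\<A> i = {} \<or> \<A> j = {}") fastforce+
  have le: "(\<Prod>i\<in>{1..k}. card (\<A> i)) \<le> (\<Prod>i\<in>{1..k}. l i)"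
    if "below k \<A> \<G>" "cross_t_intersecting t k \<A>" for \<A>
    by (rule prod_le_of_pairs) (use \<open>k \<ge> 2\<close> pair_le[OF that] in auto)
  have strict: "(\<Prod>i\<in>{1..k}. card (\<A> i)) < (\<Prod>i\<in>{1..k}. l i) \<or>
      (\<exists>T. finite T \<and> card T = t \<and> (\<forall>i\<in>{1..k}. \<A> i = containing (\<G> i) T))"
    if large: "\<forall>i\<in>{1..k}. \<exists>F\<in>\<F> i. t \<le> card F"
      and \<A>: "below k \<A> \<G>" "cross_t_intersecting t k \<A>" for \<A>
  proof (cases "(\<Prod>i\<in>{1..k}. card (\<A> i)) < (\<Prod>i\<in>{1..k}. l i)")
    case False
    then have eq: "(\<Prod>i\<in>{1..k}. card (\<A> i)) = (\<Prod>i\<in>{1..k}. l i)"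
      using le[OF \<A>] by simp
    \<comment> \<open>This yields \<open>m i \<ge> card F\<close> for each \<open>F\<close> in
      \<open>\<F> i\<close>, so injections exist, and later \<open>c \<ge> 2\<close>.\<close>
    have cr: "r k < c"
    proof -
      have "r k \<le> r k * (r (k - 1) choose t)"
        using tr[of "k - 1"] \<open>k \<ge> 2\<close> by (simp add: Suc_le_eq)
      also have "\<dots> < c"
        using cb[of "k - 1" k] \<open>k \<ge> 2\<close> by simp
      finally show ?thesis .
    qed
    have lpos: "0 < l i" if i: "i \<in> {1..k}" for i
    proof -
      obtain F where F: "F \<in> \<F> i" "t \<le> card F"
        using large i by blast
      have F': "finite F" "card F \<le> r i"
        using assms(5)[OF i] F by (auto simp: le_family_def)
      moreover have "F \<noteq> {}"
        using F \<open>1 \<le> t\<close> by auto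
      moreover have "card F \<le> m i"
        using F' assms(4)[of i k] i cr assms(6)[OF i] by (auto simp: c_def)
      ultimately obtain G where G: "G \<in> S_star F (m i)"
        using S_star_nonempty by blast
      then have "G \<in> \<G> i"
        using F by (auto simp: \<G>_def S_star_family_def)
      then show ?thesis
        unfolding l_def using fin[OF i] mem[OF i] card_S_star[OF G] F by (intro max_star_pos) auto
    qed
    \<comment> \<open>Equality with a product of positive maxima rules out empty families, so
      \<open>pair\<close> becomes applicable.\<close>
    have apos: "0 < card (\<A> i)" if "i \<in> {1..k}" for i
    proof -
      have "0 < (\<Prod>i\<in>{1..k}. card (\<A> i))"
        unfolding eq by (intro prod_pos) (use lpos in auto)
      then show ?thesis
        using that by (auto simp: prod_pos_nat_iff)
    qed
    \<comment> \<open>Index 1 serves as a hub: the centre may at first depend on \<open>j\<close>,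
      but each one is also a centre of \<open>\<A> 1\<close>.\<close>
    have star: "\<exists>T. finite T \<and> card T = t \<and> \<A> 1 = containing (\<G> 1) T \<and> \<A> j = containing (\<G> j) T \<and>
        card (\<A> 1) = l 1" if j: "j \<in> {1..k}" "j \<noteq> 1" for j
    proof -
      have one: "1 \<in> {1..k}"
        using \<open>k \<ge> 2\<close> by simp
      have "card (\<A> 1) * card (\<A> j) = l 1 * l j"
        by (rule pairs_eq_of_prod_eq[where I = "{1..k}"]) (use pair_le[OF \<A>] apos eq one j in auto)
      moreover have "\<A> 1 \<noteq> {}" "\<A> j \<noteq> {}"
        using apos[OF one] apos[OF j(1)] by auto
      ultimately show ?thesis
        using pair[OF \<A> one j(1)] j by auto
    qed
    obtain T where T: "finite T" "card T = t" "\<A> 1 = containing (\<G> 1) T" "card (\<A> 1) = l 1"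
      using star[of 2] \<open>k \<ge> 2\<close> by auto
    have "\<A> j = containing (\<G> j) T" if j: "j \<in> {1..k}" for j
    proof (cases "j = 1")
      case False
      then obtain T' where T': "finite T'" "card T' = t" "\<A> 1 = containing (\<G> 1) T'"
          "\<A> j = containing (\<G> j) T'"
        using star[OF j] by blast
      have one: "1 \<in> {1..k}"
        using \<open>k \<ge> 2\<close> by simp
      \<comment> \<open>Hence a \<open>(t+1)\<close>-star in \<open>\<G> 1\<close> has at most half
        the size of \<open>\<A> 1\<close>, as \<open>containing_inject\<close> requires.\<close>
      have "2 \<le> c"
        using cr tr[of k] \<open>1 \<le> t\<close> \<open>k \<ge> 2\<close> by auto
      have "T = T'"
      proof (rule containing_inject)
        fix U :: "('a \<times> nat) set" assume U: "finite U" "card U = Suc t"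
        have "2 * card (containing (\<G> 1) U) \<le> c * card (containing (\<G> 1) U)"
          using \<open>2 \<le> c\<close> by (rule mult_right_mono) simp
        also have "\<dots> \<le> l 1"
          using ratio[OF one U] .
        finally show "card (containing (\<G> 1) U) < card (containing (\<G> 1) T)"
          using T(3,4) lpos[OF one] by simp
      qed (use T T' fin[OF one] apos[OF one] in auto)
      then show ?thesis
        using T' by simp
    qed (use T in simp)
    then show ?thesis
      using T by blast
  qed simp
  have "cross_t_star_property t k \<G>"
    using le by (auto simp: cross_t_star_property_def l_def)
  moreover have "strict_cross_t_star_property t k \<G>" if "\<forall>i\<in>{1..k}. \<exists>F\<in>\<F> i. t \<le> card F"
    using le strict[OF that] by (auto simp: strict_cross_t_star_property_def l_def)
  ultimately show ?thesis
    unfolding \<G>_def by blast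
qed

end
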